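(* Let $n\ge1$, $\gamma>0$, $x_0\in\mathbb{R}$, $b,\sigma>0$, $\Delta>0$, and let $(\varepsilon_k)_{k\ge1}$ be i.i.d. with law $\mathcal{N}(0,1)$. Consider the mean-variance problem of minimizing $$J(\alpha)=\frac{\gamma}{2}\mathrm{Var}(X_n^\alpha)-\mathbb{E}[X_n^\alpha]$$ over $\alpha\in\mathcal{A}$, where $X_0^\alpha=x_0$ and $X_{k+1}^\alpha=X_k^\alpha+\alpha_k\big(b\Delta+\sigma\sqrt{\Delta}\,\varepsilon_{k+1}\big)$, $k=0,\ldots,n-1$. Then the value functions are $$v_k(\mu)=\frac{\gamma}{2}\Big(\frac{\sigma^2}{\sigma^2+b^2\Delta}\Big)^{n-k}\mathrm{Var}(\mu)-\bar\mu-\frac{1}{2\gamma}\Big(\Big(\frac{\sigma^2+b^2\Delta}{\sigma^2}\Big)^{n-k}-1\Big),\qquad k=0,\ldots,n,\ \mu\in\mathcal{P}_2(\mathbb{R}),$$ and an optimal control $\alpha^*\in\mathcal{A}$ (i.e. $J(\alpha^* )=\inf_{\alpha\in\mathcal{A}}J(\alpha)$) is given in feedback form, with $X^*=X^{\alpha^*}$, by $$\alpha_k^*=-\frac{b}{\sigma^2+b^2\Delta}\big(X_k^*-\mathbb{E}[X_k^*]\big)+\frac{b}{\sigma^2\gamma}\Big(\frac{\sigma^2+b^2\Delta}{\sigma^2}\Big)^{n-k-1},\qquad k=0,\ldots,n-1,$$ which is explicitly written as $$\alpha_k^*=-\frac{b}{\sigma^2+b^2\Delta}\Big[X_k^*-x_0-\frac1\gamma\Big(1+\frac{b^2}{\sigma^2}\Delta\Big)^n\Big],\qquad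 k=0,\ldots,n-1.$$
   Context: $A^E$ (with $E=A=\mathbb{R}$) is the set of measurable functions $\tilde\alpha:\mathbb{R}\to\mathbb{R}$ with linear growth, and $\mathcal{A}$ is the set of feedback controls, i.e. sequences $(\tilde\alpha_k)_k$ in $A^E$ with $\alpha_k=\tilde\alpha_k(X_k^\alpha)$ (the function $\tilde\alpha_k$ may be chosen depending on the deterministic law of $X_k^\alpha$). $\mathcal{P}_2(\mathbb{R})$ is the set of probability measures on $\mathbb{R}$ with finite second moment; $\bar\mu=\int x\,\mu(dx)$ and $\mathrm{Var}(\mu)=\int x^2\mu(dx)-\bar\mu^2$. The value functions $v_0,\ldots,v_n$ on $\mathcal{P}_2(\mathbb{R})$ are defined by the dynamic programming recursion $v_n(\mu)=\frac{\gamma}{2}\mathrm{Var}(\mu)-\bar\mu$ and $v_k(\mu)=\inf_{\tilde\alpha\in A^E}v_{k+1}\big(\Phi(\mu,\tilde\alpha)\big)$ for $k=0,\ldots,n-1$, where $\Phi(\mu,\tilde\alpha)$ is the law of $Y+\tilde\alpha(Y)(b\Delta+\sigma\sqrt\Delta\,\varepsilon)$ with $Y\sim\mu$ and $\varepsilon\sim\mathcal{N}(0,1)$ independent. *)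

theory Defs
  imports "HOL-Probability.Probability"
begin

definition lin_growth_maps :: "(real \<Rightarrow> real) set" where
  "lin_growth_maps = {a \<in> borel_measurable borel. \<exists>C. \<forall>x. \<bar>a x\<bar> \<le> C * (1 + \<bar>x\<bar>)}"

definition P2 :: "real measure set" where
  "P2 = {\<mu>. prob_space \<mu> \<and> sets \<mu> = sets borel \<and> integrable \<mu> (\<lambda>x. x\<^sup>2)}"

definition mean_of :: "real measure \<Rightarrow> real" where
  "mean_of \<mu> = (\<integral>x. x \<partial>\<mu>)"

definition Var_of :: "real measure \<Rightarrow> real" where
  "Var_of \<mu> = (\<integral>x. x\<^sup>2 \<partial>\<mu>) - (mean_of \<mu>)\<^sup>2"

definition std_normal :: "real measure" where
  "std_normal = density lborel std_normal_density"

(* The independent pair (Y, \<epsilon>) is realised canonically on the product space \<mu> \<otimes> N(0,1). *)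
definition Phi :: "real \<Rightarrow> real \<Rightarrow> real \<Rightarrow> real measure \<Rightarrow> (real \<Rightarrow> real) \<Rightarrow> real measure" where
  "Phi b \<sigma> \<Delta> \<mu> a =
     distr (\<mu> \<Otimes>\<^sub>M std_normal) borel (\<lambda>(y, e). y + a y * (b * \<Delta> + \<sigma> * sqrt \<Delta> * e))"

(* Extended-real values, so that the infimum is the genuine one without presupposing
   that the family is bounded below.  Only k \<le> n is meaningful. *)
function value_fun ::
  "real \<Rightarrow> real \<Rightarrow> real \<Rightarrow> real \<Rightarrow> nat \<Rightarrow> nat \<Rightarrow> real measure \<Rightarrow> ereal" where
  "value_fun \<gamma> b \<sigma> \<Delta> n k \<mu> =
     (if k < n
      then INF a\<in>lin_growth_maps. value_fun \<gamma> b \<sigma> \<Delta> n (Suc k) (Phi b \<sigma> \<Delta> \<mu> a)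
      else ereal (\<gamma> / 2 * Var_of \<mu> - mean_of \<mu>))"
  by pat_completeness auto
termination
  by (relation "Wellfounded.measure (\<lambda>(\<gamma>, b, \<sigma>, \<Delta>, n, k, \<mu>). n - k)") auto

declare value_fun.simps [simp del]

primrec state_process ::
  "real \<Rightarrow> real \<Rightarrow> real \<Rightarrow> real \<Rightarrow> (nat \<Rightarrow> 'a \<Rightarrow> real) \<Rightarrow> (nat \<Rightarrow> 'a \<Rightarrow> real) \<Rightarrow> nat \<Rightarrow> 'a \<Rightarrow> real" where
  "state_process b \<sigma> \<Delta> x0 \<epsilon> \<alpha> 0 = (\<lambda>\<omega>. x0)"
| "state_process b \<sigma> \<Delta> x0 \<epsilon> \<alpha> (Suc k) =
     (\<lambda>\<omega>. state_process b \<sigma> \<Delta> x0 \<epsilon> \<alpha> k \<omega>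
          + \<alpha> k \<omega> * (b * \<Delta> + \<sigma> * sqrt \<Delta> * \<epsilon> (Suc k) \<omega>))"

(* A map \<open>a k\<close> that may also depend on the law of X_k gives nothing new: that law is a fixed
   measure once the control is fixed, so it is absorbed in the choice of \<open>a k\<close>. *)
definition feedback_controls ::
  "real \<Rightarrow> real \<Rightarrow> real \<Rightarrow> real \<Rightarrow> (nat \<Rightarrow> 'a \<Rightarrow> real) \<Rightarrow> nat \<Rightarrow> 'a measure \<Rightarrow> (nat \<Rightarrow> 'a \<Rightarrow> real) set" where
  "feedback_controls b \<sigma> \<Delta> x0 \<epsilon> n M =
     {\<alpha>. \<exists>a. \<forall>k<n. a k \<in> lin_growth_maps \<and>
            (\<forall>\<omega>\<in>space M. \<alpha> k \<omega> = a k (state_process b \<sigma> \<Delta> x0 \<epsilon> \<alpha> k \<omega>))}"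

definition mv_cost ::
  "real \<Rightarrow> real \<Rightarrow> real \<Rightarrow> real \<Rightarrow> real \<Rightarrow> (nat \<Rightarrow> 'a \<Rightarrow> real) \<Rightarrow> nat \<Rightarrow> 'a measure \<Rightarrow> (nat \<Rightarrow> 'a \<Rightarrow> real) \<Rightarrow> real" where
  "mv_cost \<gamma> b \<sigma> \<Delta> x0 \<epsilon> n M \<alpha> =
     \<gamma> / 2 * prob_space.variance M (state_process b \<sigma> \<Delta> x0 \<epsilon> \<alpha> n)
     - prob_space.expectation M (state_process b \<sigma> \<Delta> x0 \<epsilon> \<alpha> n)"

end

(* Write S = sigma^2 + b^2 Delta.  If X = Y + a(Y) (b Delta + sigma sqrt(Delta) e) with e standard
   normal and independent of Y, completing the square gives
     Var X = (sigma^2/S) Var Y + Delta S Var(a(Y) + (b/S) Y) + sigma^2 Delta (E a(Y))^2,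
     E X = E Y + b Delta E a(Y).
   So a cost (c/2) Var X - E X splits into a function of the law of Y, a nonnegative variance that
   vanishes when a(y) + (b/S) y is constant, and a square that vanishes when
   E a(Y) = b/(c sigma^2).  The same one-step estimate, applied to the product measure in Phi, gives
   the value functions, and, applied along the controlled path, gives optimality. *)

theory Submission
  imports Defs
begin

section \<open>Controls of linear growth\<close>

text \<open>The bound on the square is the form in which linear growth is used: it carries square
  integrability from a state Y over to a(Y).\<close>

lemma lin_growth_mapsD:
  assumes "a \<in> lin_growth_maps"
  shows lin_growth_maps_measurable: "a \<in> borel_measurable borel"
    and lin_growth_maps_square_bound: "\<exists>C. \<forall>x. (a x)\<^sup>2 \<le> C * (1 + x\<^sup>2)"
proof -
  show "a \<in> borel_measurable borel"
    using assms by (simp add: lin_growth_maps_def)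
  obtain C where C: "\<And>x. \<bar>a x\<bar> \<le> C * (1 + \<bar>x\<bar>)"
    using assms by (auto simp: lin_growth_maps_def)
  have "(a x)\<^sup>2 \<le> 2 * C\<^sup>2 * (1 + x\<^sup>2)" for x
  proof -
    have "(a x)\<^sup>2 \<le> (C * (1 + \<bar>x\<bar>))\<^sup>2"
      using power_mono[OF C[of x], of 2] by simp
    also have "\<dots> = C\<^sup>2 * (1 + \<bar>x\<bar>)\<^sup>2"
      by (simp add: power_mult_distrib)
    also have "(1 + \<bar>x\<bar>)\<^sup>2 \<le> 2 * (1 + x\<^sup>2)"
      using zero_le_power2[of "1 - \<bar>x\<bar>"] by (simp add: power2_sum power2_diff)
    finally show ?thesis
      by (simp add: mult_left_mono mult.assoc mult.left_commute[of 2])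
  qed
  then show "\<exists>C. \<forall>x. (a x)\<^sup>2 \<le> C * (1 + x\<^sup>2)"
    by blast
qed

text \<open>The shape is that of \<open>opt_feedback\<close>, with q the mean of the state; the
  explicit control is the case r = 0 with q a fixed level.\<close>

lemma affine_lin_growth: "(\<lambda>y. p * (y - q) + r) \<in> lin_growth_maps"
proof -
  have "\<bar>p * (y - q) + r\<bar> \<le> (\<bar>p\<bar> + \<bar>p * q\<bar> + \<bar>r\<bar>) * (1 + \<bar>y\<bar>)" for y
  proof -
    have "\<bar>p * (y - q) + r\<bar> \<le> \<bar>p\<bar> * \<bar>y\<bar> + \<bar>p * q\<bar> + \<bar>r\<bar>"
      unfolding right_diff_distrib abs_mult[of p y, symmetric] by linarith
    also have "\<dots> \<le> \<bar>p\<bar> * (1 + \<bar>y\<bar>) + \<bar>p * q\<bar> * (1 + \<bar>y\<bar>) + \<bar>r\<bar> * (1 + \<bar>y\<bar>)"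
      by (intro add_mono) (simp_all add: distrib_left)
    finally show ?thesis
      by (simp only: distrib_right)
  qed
  then show ?thesis
    unfolding lin_growth_maps_def by (auto intro!: exI[of _ "\<bar>p\<bar> + \<bar>p * q\<bar> + \<bar>r\<bar>"])
qed

section \<open>Mean and variance after one controlled step\<close>

context prob_space
begin

lemma square_integrable_lin_growth:
  assumes a: "a \<in> lin_growth_maps"
    and Y [measurable]: "Y \<in> borel_measurable M" and Y2: "integrable M (\<lambda>\<omega>. (Y \<omega>)\<^sup>2)"
  shows "integrable M (\<lambda>\<omega>. (a (Y \<omega>))\<^sup>2)"
proof -
  note [measurable] = lin_growth_maps_measurable[OF a]
  obtain C where C: "\<And>x. (a x)\<^sup>2 \<le> C * (1 + x\<^sup>2)"
    using lin_growth_maps_square_bound[OF a] by blast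
  have "integrable M (\<lambda>\<omega>. C * (1 + (Y \<omega>)\<^sup>2))"
    using Y2 by simp
  then show ?thesis
    by (rule Bochner_Integration.integrable_bound) (auto intro!: AE_I2 order_trans[OF C])
qed

lemma integrable_mult_square_integrable:
  fixes X Y :: "'a \<Rightarrow> real"
  assumes [measurable]: "X \<in> borel_measurable M" "Y \<in> borel_measurable M"
    and "integrable M (\<lambda>\<omega>. (X \<omega>)\<^sup>2)" "integrable M (\<lambda>\<omega>. (Y \<omega>)\<^sup>2)"
  shows "integrable M (\<lambda>\<omega>. X \<omega> * Y \<omega>)"
proof (rule Bochner_Integration.integrable_bound)
  show "integrable M (\<lambda>\<omega>. (X \<omega>)\<^sup>2 + (Y \<omega>)\<^sup>2)"
    using assms by simp
  have "\<bar>x * y\<bar> \<le> x\<^sup>2 + y\<^sup>2" for x y :: real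
    using sum_squares_bound[of "\<bar>x\<bar>" "\<bar>y\<bar>"] mult_nonneg_nonneg[of "\<bar>x\<bar>" "\<bar>y\<bar>"]
    unfolding abs_mult power2_abs by linarith
  then show "AE \<omega> in M. norm (X \<omega> * Y \<omega>) \<le> norm ((X \<omega>)\<^sup>2 + (Y \<omega>)\<^sup>2)"
    by (auto intro!: AE_I2)
qed simp

lemma std_normal_square:
  assumes "distributed M lborel e std_normal_density"
  shows "integrable M (\<lambda>\<omega>. (e \<omega>)\<^sup>2)" and "expectation (\<lambda>\<omega>. (e \<omega>)\<^sup>2) = 1"
proof -
  show "integrable M (\<lambda>\<omega>. (e \<omega>)\<^sup>2)"
    using distributed_integrable[OF assms, of "\<lambda>x. x\<^sup>2"] integrable_std_normal_moment[of 2]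
    by simp
  show "expectation (\<lambda>\<omega>. (e \<omega>)\<^sup>2) = 1"
    using distributed_integral[OF assms, of "\<lambda>x. x\<^sup>2"] integral_std_normal_moment_even[of 1]
    by simp
qed

text \<open>Put A = a(Y). Independence together with E e = 0 and E e^2 = 1 gives Var X = Var Y + 2 b
  Delta Cov(Y, A) + b^2 Delta^2 Var A + sigma^2 Delta E A^2. Writing E A^2 = Var A + (E A)^2 raises
  the coefficient of Var A to Delta S, and completing the square in the covariance form gives the
  variance of A + (b/S) Y. What remains of Var Y has the coefficient 1 - b^2 Delta / S = sigma^2 /
  S.\<close>

lemma controlled_step_moments:
  fixes b \<sigma> \<Delta> :: real
  assumes a: "a \<in> lin_growth_maps" and ind: "indep_var borel Y borel e"
    and e: "distributed M lborel e std_normal_density"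
    and Y2: "integrable M (\<lambda>\<omega>. (Y \<omega>)\<^sup>2)" and \<sigma>: "\<sigma> > 0" and \<Delta>: "\<Delta> > 0"
  defines "S \<equiv> \<sigma>\<^sup>2 + b\<^sup>2 * \<Delta>"
    and "X \<equiv> \<lambda>\<omega>. Y \<omega> + a (Y \<omega>) * (b * \<Delta> + \<sigma> * sqrt \<Delta> * e \<omega>)"
  shows "integrable M (\<lambda>\<omega>. (X \<omega>)\<^sup>2)"
    and "expectation X = expectation Y + b * \<Delta> * expectation (\<lambda>\<omega>. a (Y \<omega>))"
    and "variance X = \<sigma>\<^sup>2 / S * variance Y + \<Delta> * S * variance (\<lambda>\<omega>. a (Y \<omega>) + b / S * Y \<omega>)
           + \<sigma>\<^sup>2 * \<Delta> * (expectation (\<lambda>\<omega>. a (Y \<omega>)))\<^sup>2"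
proof -
  note [measurable] = lin_growth_maps_measurable[OF a]
  have [measurable]: "Y \<in> borel_measurable M" "e \<in> borel_measurable M"
    using indep_var_rv1[OF ind] indep_var_rv2[OF ind] by auto
  have S: "S > 0"
    using \<sigma> \<Delta> by (simp add: S_def add_pos_nonneg)
  define A where "A = (\<lambda>\<omega>. a (Y \<omega>))"
  have [measurable]: "A \<in> borel_measurable M"
    by (simp add: A_def)
  note e2 = std_normal_square[OF e]
  have e1: "expectation e = 0"
    by (rule standard_normal_distributed_expectation[OF e])
  have A2: "integrable M (\<lambda>\<omega>. (A \<omega>)\<^sup>2)"
    unfolding A_def by (rule square_integrable_lin_growth[OF a _ Y2]) simp
  have YA: "integrable M (\<lambda>\<omega>. Y \<omega> * A \<omega>)"
    by (rule integrable_mult_square_integrable) (use Y2 A2 in simp_all)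
  have A1: "integrable M A" and Y1: "integrable M Y" and ei: "integrable M e"
    using A2 Y2 e2 by (auto intro: square_integrable_imp_integrable)
  \<comment> \<open>Borel functions of Y and of e are again independent, so expectations of products
    factor. Every mixed term in the expansion of X^2 is of this kind: f is one of a(y), y a(y),
    a(y)^2, and g is the identity or the square.\<close>
  have prod: "integrable M (\<lambda>\<omega>. f (Y \<omega>) * g (e \<omega>)) \<and>
      expectation (\<lambda>\<omega>. f (Y \<omega>) * g (e \<omega>)) = expectation (\<lambda>\<omega>. f (Y \<omega>)) * expectation (\<lambda>\<omega>. g (e \<omega>))"
    if meas: "f \<in> borel_measurable borel" "g \<in> borel_measurable borel"
      and int: "integrable M (\<lambda>\<omega>. f (Y \<omega>))" "integrable M (\<lambda>\<omega>. g (e \<omega>))"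
    for f g :: "real \<Rightarrow> real"
  proof -
    have "indep_var borel (\<lambda>\<omega>. f (Y \<omega>)) borel (\<lambda>\<omega>. g (e \<omega>))"
      using indep_var_compose[OF ind meas] by (simp add: comp_def)
    then show ?thesis
      using indep_var_integrable[OF _ int] indep_var_lebesgue_integral[OF _ int] by blast
  qed
  have meas: "a \<in> borel_measurable borel" "(\<lambda>y. y * a y) \<in> borel_measurable borel"
      "(\<lambda>y. (a y)\<^sup>2) \<in> borel_measurable borel" "(\<lambda>x::real. x) \<in> borel_measurable borel"
      "(\<lambda>x::real. x\<^sup>2) \<in> borel_measurable borel"
    by measurable
  have Ae: "integrable M (\<lambda>\<omega>. A \<omega> * e \<omega>)" "expectation (\<lambda>\<omega>. A \<omega> * e \<omega>) = 0"
    using prod[OF meas(1,4) A1[unfolded A_def] ei] unfolding A_def e1 by simp_all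
  have YAe: "integrable M (\<lambda>\<omega>. Y \<omega> * A \<omega> * e \<omega>)" "expectation (\<lambda>\<omega>. Y \<omega> * A \<omega> * e \<omega>) = 0"
    using prod[OF meas(2,4) YA[unfolded A_def] ei] unfolding A_def e1 by simp_all
  have AAe: "integrable M (\<lambda>\<omega>. (A \<omega>)\<^sup>2 * e \<omega>)" "expectation (\<lambda>\<omega>. (A \<omega>)\<^sup>2 * e \<omega>) = 0"
    using prod[OF meas(3,4) A2[unfolded A_def] ei] unfolding A_def e1 by simp_all
  have AAee: "integrable M (\<lambda>\<omega>. (A \<omega>)\<^sup>2 * (e \<omega>)\<^sup>2)"
      "expectation (\<lambda>\<omega>. (A \<omega>)\<^sup>2 * (e \<omega>)\<^sup>2) = expectation (\<lambda>\<omega>. (A \<omega>)\<^sup>2)"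
    using prod[OF meas(3,5) A2[unfolded A_def] e2(1)] unfolding A_def e2(2) by simp_all
  \<comment> \<open>The terms linear in \<open>s\<close> have expectation zero, so only
    \<open>s\<^sup>2\<close> enters the moments and the square root disappears through
    \<open>s2\<close>.\<close>
  define s where "s = \<sigma> * sqrt \<Delta>"
  have s2: "s\<^sup>2 = \<sigma>\<^sup>2 * \<Delta>"
    using \<Delta> by (simp add: s_def power_mult_distrib)
  have X_eq: "X = (\<lambda>\<omega>. Y \<omega> + b * \<Delta> * A \<omega> + s * (A \<omega> * e \<omega>))"
    by (simp add: X_def A_def s_def fun_eq_iff algebra_simps)
  have X2_eq: "(\<lambda>\<omega>. (X \<omega>)\<^sup>2) = (\<lambda>\<omega>. (Y \<omega>)\<^sup>2 + 2 * b * \<Delta> * (Y \<omega> * A \<omega>) + (b * \<Delta>)\<^sup>2 * (A \<omega>)\<^sup>2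
      + 2 * s * (Y \<omega> * A \<omega> * e \<omega>) + 2 * b * \<Delta> * s * ((A \<omega>)\<^sup>2 * e \<omega>) + s\<^sup>2 * ((A \<omega>)\<^sup>2 * (e \<omega>)\<^sup>2))"
    unfolding X_eq by (simp add: fun_eq_iff power2_eq_square algebra_simps)
  show X2: "integrable M (\<lambda>\<omega>. (X \<omega>)\<^sup>2)"
    unfolding X2_eq
    by (intro Bochner_Integration.integrable_add integrable_mult_right Y2 YA A2 YAe AAe AAee)
  have X1: "integrable M X"
    unfolding X_eq by (intro Bochner_Integration.integrable_add integrable_mult_right Y1 A1 Ae)
  have EX: "expectation X = expectation Y + b * \<Delta> * expectation A"
    unfolding X_eq using Y1 A1 Ae by simp
  then show "expectation X = expectation Y + b * \<Delta> * expectation (\<lambda>\<omega>. a (Y \<omega>))"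
    by (simp add: A_def)
  have EX2: "expectation (\<lambda>\<omega>. (X \<omega>)\<^sup>2) = expectation (\<lambda>\<omega>. (Y \<omega>)\<^sup>2)
      + 2 * b * \<Delta> * expectation (\<lambda>\<omega>. Y \<omega> * A \<omega>) + ((b * \<Delta>)\<^sup>2 + s\<^sup>2) * expectation (\<lambda>\<omega>. (A \<omega>)\<^sup>2)"
    unfolding X2_eq using Y2 YA A2 YAe AAe AAee by (simp add: distrib_right)
  have B2_eq: "(\<lambda>\<omega>. (A \<omega> + b / S * Y \<omega>)\<^sup>2) =
      (\<lambda>\<omega>. (A \<omega>)\<^sup>2 + 2 * (b / S) * (Y \<omega> * A \<omega>) + (b / S)\<^sup>2 * (Y \<omega>)\<^sup>2)"
    by (simp only: fun_eq_iff power2_eq_square) (simp add: algebra_simps)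
  have B2: "integrable M (\<lambda>\<omega>. (A \<omega> + b / S * Y \<omega>)\<^sup>2)"
    unfolding B2_eq by (intro Bochner_Integration.integrable_add integrable_mult_right Y2 YA A2)
  have B1: "integrable M (\<lambda>\<omega>. A \<omega> + b / S * Y \<omega>)"
    by (intro Bochner_Integration.integrable_add integrable_mult_right Y1 A1)
  have EB: "expectation (\<lambda>\<omega>. A \<omega> + b / S * Y \<omega>) = expectation A + b / S * expectation Y"
    using A1 Y1 by simp
  have EB2: "expectation (\<lambda>\<omega>. (A \<omega> + b / S * Y \<omega>)\<^sup>2) = expectation (\<lambda>\<omega>. (A \<omega>)\<^sup>2)
      + 2 * (b / S) * expectation (\<lambda>\<omega>. Y \<omega> * A \<omega>) + (b / S)\<^sup>2 * expectation (\<lambda>\<omega>. (Y \<omega>)\<^sup>2)"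
    unfolding B2_eq using Y2 YA A2 by simp
  \<comment> \<open>This is the completed square with the moments replaced by free reals:
    \<open>y2\<close>, \<open>c\<close>, \<open>p\<close>, \<open>y\<close>, \<open>q\<close> stand
    for E Y^2, E (Y A), E A^2, E Y, E A. Once each variance is written as a second moment minus a
    squared mean, the variance formula is an instance of it.\<close>
  have alg: "(y2 + 2 * b * \<Delta> * c + ((b * \<Delta>)\<^sup>2 + s\<^sup>2) * p) - (y + b * \<Delta> * q)\<^sup>2 =
      \<sigma>\<^sup>2 / S * (y2 - y\<^sup>2)
      + \<Delta> * S * ((p + 2 * (b / S) * c + (b / S)\<^sup>2 * y2) - (q + b / S * y)\<^sup>2) + \<sigma>\<^sup>2 * \<Delta> * q\<^sup>2"
    for y2 c p y q :: real
  proof -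
    have *: "b * b * \<Delta> = S - \<sigma>\<^sup>2"
      by (simp add: S_def power2_eq_square)
    have "\<Delta> * S * ((p + 2 * (b / S) * c + (b / S)\<^sup>2 * y2) - (q + b / S * y)\<^sup>2) =
        \<Delta> * S * (p - q\<^sup>2) + 2 * b * \<Delta> * (c - y * q) + (b * b * \<Delta>) / S * (y2 - y\<^sup>2)"
      using S by (simp add: power2_eq_square field_simps)
    also have "\<dots> = \<Delta> * S * (p - q\<^sup>2) + 2 * b * \<Delta> * (c - y * q) + (y2 - y\<^sup>2) - \<sigma>\<^sup>2 / S * (y2 - y\<^sup>2)"
      unfolding * using S by (simp add: field_simps)
    finally show ?thesis
      unfolding s2 by (simp add: S_def power2_eq_square algebra_simps)
  qed
  have "variance X = \<sigma>\<^sup>2 / S * variance Y + \<Delta> * S * variance (\<lambda>\<omega>. A \<omega> + b / S * Y \<omega>)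
      + \<sigma>\<^sup>2 * \<Delta> * (expectation A)\<^sup>2"
    unfolding variance_eq[OF X1 X2] variance_eq[OF Y1 Y2] variance_eq[OF B1 B2]
    unfolding EX EX2 EB EB2 by (rule alg)
  then show "variance X = \<sigma>\<^sup>2 / S * variance Y
      + \<Delta> * S * variance (\<lambda>\<omega>. a (Y \<omega>) + b / S * Y \<omega>)
      + \<sigma>\<^sup>2 * \<Delta> * (expectation (\<lambda>\<omega>. a (Y \<omega>)))\<^sup>2"
    by (simp add: A_def)
qed

end

section \<open>The cost-to-go and the optimal feedback\<close>

text \<open>The claimed value with \<open>m\<close> steps left, as a function of the variance
  \<open>V\<close> and the mean \<open>e\<close> alone. In this form it applies both to laws and to
  random variables; \<open>m = 0\<close> gives the terminal cost.\<close>

definition cost_to_go :: "real \<Rightarrow> real \<Rightarrow> real \<Rightarrow> real \<Rightarrow> nat \<Rightarrow> real \<Rightarrow> real \<Rightarrow> real" where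
  "cost_to_go \<gamma> b \<sigma> \<Delta> m V e =
     \<gamma> / 2 * (\<sigma>\<^sup>2 / (\<sigma>\<^sup>2 + b\<^sup>2 * \<Delta>)) ^ m * V - e
     - 1 / (2 * \<gamma>) * (((\<sigma>\<^sup>2 + b\<^sup>2 * \<Delta>) / \<sigma>\<^sup>2) ^ m - 1)"

text \<open>Here \<open>m\<close> counts the steps left after the current one, so
  \<open>m = n - k - 1\<close> at time k, and \<open>e\<close> is the mean of the current
  state.\<close>

definition opt_feedback :: "real \<Rightarrow> real \<Rightarrow> real \<Rightarrow> real \<Rightarrow> nat \<Rightarrow> real \<Rightarrow> real \<Rightarrow> real" where
  "opt_feedback \<gamma> b \<sigma> \<Delta> m e y =
     - (b / (\<sigma>\<^sup>2 + b\<^sup>2 * \<Delta>)) * (y - e) + b / (\<sigma>\<^sup>2 * \<gamma>) * ((\<sigma>\<^sup>2 + b\<^sup>2 * \<Delta>) / \<sigma>\<^sup>2) ^ m"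

lemma opt_feedback_lin_growth: "opt_feedback \<gamma> b \<sigma> \<Delta> m e \<in> lin_growth_maps"
  unfolding opt_feedback_def[abs_def] by (rule affine_lin_growth)

text \<open>With c = \<gamma> (sigma^2/S)^m, the terms in q are (c/2) sigma^2 Delta q^2 - b Delta q,
  a parabola with vertex b/(c sigma^2) and minimum -b^2 Delta / (2 c sigma^2). Since b^2 Delta /
  sigma^2 = S/sigma^2 - 1, this minimum is exactly the change of the additive constant of
  \<open>cost_to_go\<close> from m to m + 1. The variable \<open>P\<close> is a placeholder for the
  variance of a(Y) + (b/S) Y.\<close>

lemma cost_to_go_complete_square:
  fixes \<gamma> b \<sigma> \<Delta> :: real
  assumes \<gamma>: "\<gamma> > 0" and \<sigma>: "\<sigma> > 0" and \<Delta>: "\<Delta> > 0"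
  defines "S \<equiv> \<sigma>\<^sup>2 + b\<^sup>2 * \<Delta>"
  shows "cost_to_go \<gamma> b \<sigma> \<Delta> m (\<sigma>\<^sup>2 / S * V + \<Delta> * S * P + \<sigma>\<^sup>2 * \<Delta> * q\<^sup>2) (e + b * \<Delta> * q) =
    cost_to_go \<gamma> b \<sigma> \<Delta> (Suc m) V e
    + \<gamma> / 2 * (\<sigma>\<^sup>2 / S) ^ m * (\<Delta> * S * P + \<sigma>\<^sup>2 * \<Delta> * (q - b / (\<sigma>\<^sup>2 * \<gamma>) * (S / \<sigma>\<^sup>2) ^ m)\<^sup>2)"
proof -
  have S: "S > 0"
    using \<sigma> \<Delta> by (simp add: S_def add_pos_nonneg)
  define p where "p = (S / \<sigma>\<^sup>2) ^ m"
  have p: "p > 0"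
    using S \<sigma> by (simp add: p_def)
  have r: "(\<sigma>\<^sup>2 / S) ^ m = 1 / p"
    by (simp add: p_def power_divide)
  have "\<gamma> / 2 * (1 / p) * (\<sigma>\<^sup>2 * \<Delta> * (q - b / (\<sigma>\<^sup>2 * \<gamma>) * p)\<^sup>2) =
      \<gamma> / 2 * (1 / p) * (\<sigma>\<^sup>2 * \<Delta> * q\<^sup>2) - b * \<Delta> * q + b\<^sup>2 * \<Delta> / \<sigma>\<^sup>2 * p / (2 * \<gamma>)"
    using p \<gamma> \<sigma> by (simp add: power2_eq_square field_simps)
  moreover have "b\<^sup>2 * \<Delta> / \<sigma>\<^sup>2 = S / \<sigma>\<^sup>2 - 1"
    using \<sigma> by (simp add: S_def field_simps)
  ultimately have sq: "\<gamma> / 2 * (1 / p) * (\<sigma>\<^sup>2 * \<Delta> * (q - b / (\<sigma>\<^sup>2 * \<gamma>) * p)\<^sup>2) =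
      \<gamma> / 2 * (1 / p) * (\<sigma>\<^sup>2 * \<Delta> * q\<^sup>2) - b * \<Delta> * q + (S / \<sigma>\<^sup>2 - 1) * p / (2 * \<gamma>)"
    by simp
  have c: "1 / (2 * \<gamma>) * (S / \<sigma>\<^sup>2 * p - 1) = 1 / (2 * \<gamma>) * (p - 1) + (S / \<sigma>\<^sup>2 - 1) * p / (2 * \<gamma>)"
    by (simp add: add_divide_distrib[symmetric] diff_divide_distrib[symmetric] left_diff_distrib)
  have v: "\<gamma> / 2 * (\<sigma>\<^sup>2 / S * (1 / p)) * V = \<gamma> / 2 * (1 / p) * (\<sigma>\<^sup>2 / S * V)"
    by (simp add: mult_ac)
  show ?thesis
    unfolding cost_to_go_def S_def[symmetric] power_Suc p_def[symmetric] r distrib_left sq c v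
    by simp
qed

context prob_space
begin

text \<open>By \<open>cost_to_go_complete_square\<close> the two sides differ by a positive weight
  times the sum of a variance and a square, both with positive coefficients. Dropping them gives the
  inequality, and the feedback \<open>opt_feedback\<close> makes both vanish.\<close>

lemma cost_to_go_controlled_step:
  fixes \<gamma> b \<sigma> \<Delta> :: real
  assumes a: "a \<in> lin_growth_maps" and ind: "indep_var borel Y borel e"
    and e: "distributed M lborel e std_normal_density"
    and Y2: "integrable M (\<lambda>\<omega>. (Y \<omega>)\<^sup>2)" and pos: "\<gamma> > 0" "\<sigma> > 0" "\<Delta> > 0"
  defines "X \<equiv> \<lambda>\<omega>. Y \<omega> + a (Y \<omega>) * (b * \<Delta> + \<sigma> * sqrt \<Delta> * e \<omega>)"
  shows cost_to_go_controlled_step_le: "cost_to_go \<gamma> b \<sigma> \<Delta> (Suc m) (variance Y) (expectation Y)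
           \<le> cost_to_go \<gamma> b \<sigma> \<Delta> m (variance X) (expectation X)"
    and cost_to_go_controlled_step_eq: "a = opt_feedback \<gamma> b \<sigma> \<Delta> m (expectation Y) \<Longrightarrow>
         cost_to_go \<gamma> b \<sigma> \<Delta> m (variance X) (expectation X)
           = cost_to_go \<gamma> b \<sigma> \<Delta> (Suc m) (variance Y) (expectation Y)"
proof -
  define S where "S = \<sigma>\<^sup>2 + b\<^sup>2 * \<Delta>"
  define P where "P = variance (\<lambda>\<omega>. a (Y \<omega>) + b / S * Y \<omega>)"
  define q where "q = expectation (\<lambda>\<omega>. a (Y \<omega>))"
  have S: "S > 0"
    using pos by (simp add: S_def add_pos_nonneg)
  note mom = controlled_step_moments[OF a ind e Y2 pos(2,3), of b, folded S_def]
  have EX: "expectation X = expectation Y + b * \<Delta> * q"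
    unfolding X_def q_def by (rule mom(2))
  have VX: "variance X = \<sigma>\<^sup>2 / S * variance Y + \<Delta> * S * P + \<sigma>\<^sup>2 * \<Delta> * q\<^sup>2"
    unfolding X_def P_def q_def by (rule mom(3))
  have eq: "cost_to_go \<gamma> b \<sigma> \<Delta> m (variance X) (expectation X) =
    cost_to_go \<gamma> b \<sigma> \<Delta> (Suc m) (variance Y) (expectation Y)
    + \<gamma> / 2 * (\<sigma>\<^sup>2 / S) ^ m * (\<Delta> * S * P + \<sigma>\<^sup>2 * \<Delta> * (q - b / (\<sigma>\<^sup>2 * \<gamma>) * (S / \<sigma>\<^sup>2) ^ m)\<^sup>2)"
    using arg_cong2[OF VX EX, of "cost_to_go \<gamma> b \<sigma> \<Delta> m"]
    by (rule trans) (rule cost_to_go_complete_square[OF pos, of b m, folded S_def])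
  have P: "P \<ge> 0"
    unfolding P_def by simp
  show "cost_to_go \<gamma> b \<sigma> \<Delta> (Suc m) (variance Y) (expectation Y)
      \<le> cost_to_go \<gamma> b \<sigma> \<Delta> m (variance X) (expectation X)"
    unfolding eq using pos S P by simp
  assume opt: "a = opt_feedback \<gamma> b \<sigma> \<Delta> m (expectation Y)"
  have [measurable]: "Y \<in> borel_measurable M"
    using indep_var_rv1[OF ind] by simp
  have Y1: "integrable M Y"
    using Y2 by (auto intro: square_integrable_imp_integrable)
  \<comment> \<open>The part of the feedback proportional to Y - E Y has mean zero, so the mean of
    a(Y) is its constant term, which is the vertex of the parabola.\<close>
  have "q = b / (\<sigma>\<^sup>2 * \<gamma>) * (S / \<sigma>\<^sup>2) ^ m"
    unfolding q_def opt opt_feedback_def S_def[symmetric] using Y1 by (simp add: prob_space)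
  moreover have "P = 0"
  proof -
    \<comment> \<open>The slope -b/S of the feedback cancels (b/S) Y, leaving a constant, whose
      variance is zero.\<close>
    have const: "a (Y \<omega>) + b / S * Y \<omega>
        = b / S * expectation Y + b / (\<sigma>\<^sup>2 * \<gamma>) * (S / \<sigma>\<^sup>2) ^ m" for \<omega>
      unfolding opt opt_feedback_def S_def[symmetric] by (simp add: right_diff_distrib)
    show ?thesis
      unfolding P_def const by (simp add: prob_space)
  qed
  ultimately show "cost_to_go \<gamma> b \<sigma> \<Delta> m (variance X) (expectation X)
      = cost_to_go \<gamma> b \<sigma> \<Delta> (Suc m) (variance Y) (expectation Y)"
    unfolding eq by simp
qed

end

section \<open>The transition of laws on the product space\<close>

lemma prob_space_std_normal: "prob_space std_normal"
  unfolding std_normal_def by (rule prob_space_normal_density) simp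

lemma sets_std_normal [measurable_cong]: "sets std_normal = sets borel"
  by (simp add: std_normal_def)

lemma distr_pair_snd:
  assumes "prob_space M" "prob_space N"
  shows "distr (M \<Otimes>\<^sub>M N) N snd = N"
proof -
  interpret M: prob_space M by fact
  interpret N: prob_space N by fact
  interpret pair_prob_space M N ..
  show ?thesis
  proof (intro measure_eqI)
    fix A assume "A \<in> sets (distr (M \<Otimes>\<^sub>M N) N snd)"
    then have A: "A \<in> sets N" by simp
    then have "snd -` A \<inter> space (M \<Otimes>\<^sub>M N) = space M \<times> A"
      using sets.sets_into_space[OF A] by (auto simp: space_pair_measure)
    with A show "emeasure (distr (M \<Otimes>\<^sub>M N) N snd) A = emeasure N A"
      by (simp add: emeasure_distr N.emeasure_pair_measure_Times M.emeasure_space_1)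
  qed simp
qed

text \<open>These facts make the product space behind \<open>Phi\<close> an instance of the abstract
  one-step setting, with Y = \<open>fst\<close> and e = \<open>snd\<close>.\<close>

lemma P2_fst_snd:
  assumes \<mu>: "\<mu> \<in> P2"
  defines "N \<equiv> \<mu> \<Otimes>\<^sub>M std_normal"
  shows "prob_space N"
    and "prob_space.indep_var N borel fst borel snd"
    and "distributed N lborel snd std_normal_density"
    and "distr N borel fst = \<mu>"
proof -
  have sets [measurable_cong]: "sets \<mu> = sets borel"
    using \<mu> by (simp add: P2_def)
  interpret \<mu>: prob_space \<mu>
    using \<mu> by (simp add: P2_def)
  interpret g: prob_space std_normal
    by (rule prob_space_std_normal)
  interpret pair_prob_space \<mu> std_normal ..
  show "prob_space N"
    unfolding N_def by (rule P.prob_space_axioms)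
  have fst: "distr N borel fst = \<mu>"
    unfolding N_def using g.distr_pair_fst[of \<mu>] sets by (simp cong: distr_cong)
  then show "distr N borel fst = \<mu>" .
  \<comment> \<open>Both target measures are needed: \<open>borel\<close> for independence and
    \<open>lborel\<close> for the density.\<close>
  have "distr N borel snd = std_normal" "distr N lborel snd = std_normal"
    unfolding N_def using distr_pair_snd[OF \<mu>.prob_space_axioms g.prob_space_axioms] sets_std_normal
    by (simp_all cong: distr_cong)
  note snd = this
  show "prob_space.indep_var N borel fst borel snd"
    unfolding N_def P.indep_var_distribution_eq
  proof (intro conjI)
    \<comment> \<open>The pair of the two projections is the identity map, so the joint law is the
      product measure itself.\<close>
    show "distr (\<mu> \<Otimes>\<^sub>M std_normal) borel fst \<Otimes>\<^sub>M distr (\<mu> \<Otimes>\<^sub>M std_normal) borel snd =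
        distr (\<mu> \<Otimes>\<^sub>M std_normal) (borel \<Otimes>\<^sub>M borel) (\<lambda>x. (fst x, snd x))"
      using fst snd unfolding N_def
      by (simp, subst distr_id2) (auto intro!: sets_pair_measure_cong simp: sets sets_std_normal)
  qed measurable
  show "distributed N lborel snd std_normal_density"
    unfolding distributed_def snd by (auto simp: std_normal_def N_def)
qed

text \<open>Translates between functionals of a law and moments of a random variable; below it is
  applied to the new state and to \<open>fst\<close>, whose law is \<mu>.\<close>

lemma Var_of_distr:
  assumes "prob_space M" "X \<in> borel_measurable M" "integrable M (\<lambda>\<omega>. (X \<omega>)\<^sup>2)"
  shows "Var_of (distr M borel X) = prob_space.variance M X"
    and "mean_of (distr M borel X) = prob_space.expectation M X"
    and "distr M borel X \<in> P2"
proof -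
  interpret prob_space M by fact
  have X1: "integrable M X"
    using assms by (auto intro: square_integrable_imp_integrable)
  show mean: "mean_of (distr M borel X) = expectation X"
    using assms by (simp add: mean_of_def integral_distr)
  show "Var_of (distr M borel X) = variance X"
    unfolding Var_of_def mean variance_eq[OF X1 assms(3)] using assms by (simp add: integral_distr)
  show "distr M borel X \<in> P2"
    using assms by (simp add: P2_def prob_space_distr integrable_distr_eq)
qed

text \<open>The one-step comparison \<open>cost_to_go_controlled_step\<close>, read on the product
  space and stated for laws. Closure of \<open>P2\<close> under the transition allows the comparison
  to be iterated.\<close>

lemma cost_to_go_Phi:
  fixes \<gamma> b \<sigma> \<Delta> :: real
  assumes \<mu>: "\<mu> \<in> P2" and a: "a \<in> lin_growth_maps" and pos: "\<gamma> > 0" "\<sigma> > 0" "\<Delta> > 0"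
  defines "\<nu> \<equiv> Phi b \<sigma> \<Delta> \<mu> a"
  shows Phi_in_P2: "\<nu> \<in> P2"
    and cost_to_go_Phi_le: "cost_to_go \<gamma> b \<sigma> \<Delta> (Suc m) (Var_of \<mu>) (mean_of \<mu>)
           \<le> cost_to_go \<gamma> b \<sigma> \<Delta> m (Var_of \<nu>) (mean_of \<nu>)"
    and cost_to_go_Phi_eq: "a = opt_feedback \<gamma> b \<sigma> \<Delta> m (mean_of \<mu>) \<Longrightarrow>
         cost_to_go \<gamma> b \<sigma> \<Delta> m (Var_of \<nu>) (mean_of \<nu>)
           = cost_to_go \<gamma> b \<sigma> \<Delta> (Suc m) (Var_of \<mu>) (mean_of \<mu>)"
proof -
  define N where "N = \<mu> \<Otimes>\<^sub>M std_normal"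
  note N = P2_fst_snd[OF \<mu>, folded N_def]
  interpret N: prob_space N by (rule N(1))
  note [measurable] = N.indep_var_rv1[OF N(2)] N.indep_var_rv2[OF N(2)] lin_growth_maps_measurable[OF a]
  have "integrable (distr N borel fst) (\<lambda>x. x\<^sup>2)"
    unfolding N(4) using \<mu> by (simp add: P2_def)
  then have Y2: "integrable N (\<lambda>x. (fst x)\<^sup>2)"
    by (subst (asm) integrable_distr_eq) simp_all
  define X where "X = (\<lambda>x. fst x + a (fst x) * (b * \<Delta> + \<sigma> * sqrt \<Delta> * snd x))"
  have [measurable]: "X \<in> borel_measurable N"
    unfolding X_def by measurable
  have \<nu>: "\<nu> = distr N borel X"
    unfolding \<nu>_def Phi_def N_def X_def by (simp add: case_prod_beta')
  have X2: "integrable N (\<lambda>x. (X x)\<^sup>2)"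
    unfolding X_def by (rule N.controlled_step_moments(1)[OF a N(2,3) Y2 pos(2,3)])
  note dX = Var_of_distr[OF N(1) _ X2, folded \<nu>, simplified]
  note dY = Var_of_distr[OF N(1) _ Y2, unfolded N(4), simplified]
  show "\<nu> \<in> P2"
    by (rule dX)
  show "cost_to_go \<gamma> b \<sigma> \<Delta> (Suc m) (Var_of \<mu>) (mean_of \<mu>)
      \<le> cost_to_go \<gamma> b \<sigma> \<Delta> m (Var_of \<nu>) (mean_of \<nu>)"
    unfolding dX dY X_def by (rule N.cost_to_go_controlled_step_le[OF a N(2,3) Y2 pos])
  assume "a = opt_feedback \<gamma> b \<sigma> \<Delta> m (mean_of \<mu>)"
  then show "cost_to_go \<gamma> b \<sigma> \<Delta> m (Var_of \<nu>) (mean_of \<nu>)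
      = cost_to_go \<gamma> b \<sigma> \<Delta> (Suc m) (Var_of \<mu>) (mean_of \<mu>)"
    unfolding dX dY X_def by (intro N.cost_to_go_controlled_step_eq[OF a N(2,3) Y2 pos])
qed

section \<open>The value functions\<close>

text \<open>Backward induction from k = n. At each step every control bounds the infimum from below
  through \<open>cost_to_go_Phi_le\<close>, and the optimal feedback attains the bound.\<close>

lemma value_fun_eq_cost_to_go:
  fixes \<gamma> b \<sigma> \<Delta> :: real
  assumes pos: "\<gamma> > 0" "\<sigma> > 0" "\<Delta> > 0"
  shows "k \<le> n \<Longrightarrow> \<mu> \<in> P2 \<Longrightarrow>
    value_fun \<gamma> b \<sigma> \<Delta> n k \<mu> = ereal (cost_to_go \<gamma> b \<sigma> \<Delta> (n - k) (Var_of \<mu>) (mean_of \<mu>))"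
proof (induction k arbitrary: \<mu> rule: inc_induct)
  case base
  then show ?case
    by (simp add: value_fun.simps[of _ _ _ _ n n] cost_to_go_def)
next
  case (step k)
  have nk: "n - k = Suc (n - Suc k)"
    using step.hyps by simp
  have IH: "value_fun \<gamma> b \<sigma> \<Delta> n (Suc k) (Phi b \<sigma> \<Delta> \<mu> a) = ereal (cost_to_go \<gamma> b \<sigma> \<Delta> (n - Suc k)
      (Var_of (Phi b \<sigma> \<Delta> \<mu> a)) (mean_of (Phi b \<sigma> \<Delta> \<mu> a)))"
    if "a \<in> lin_growth_maps" for a
    using step.IH Phi_in_P2[OF step.prems that pos] by blast
  have "value_fun \<gamma> b \<sigma> \<Delta> n k \<mu> =
      (INF a\<in>lin_growth_maps. value_fun \<gamma> b \<sigma> \<Delta> n (Suc k) (Phi b \<sigma> \<Delta> \<mu> a))"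
    using step.hyps by (simp add: value_fun.simps[of _ _ _ _ n k])
  also have "\<dots> = ereal (cost_to_go \<gamma> b \<sigma> \<Delta> (n - k) (Var_of \<mu>) (mean_of \<mu>))"
  proof (rule antisym)
    \<comment> \<open>The infimum is taken for each law separately, so the minimizer may contain the
      mean of \<mu>.\<close>
    let ?a = "opt_feedback \<gamma> b \<sigma> \<Delta> (n - Suc k) (mean_of \<mu>)"
    have opt: "?a \<in> lin_growth_maps"
      by (rule opt_feedback_lin_growth)
    show "(INF a\<in>lin_growth_maps. value_fun \<gamma> b \<sigma> \<Delta> n (Suc k) (Phi b \<sigma> \<Delta> \<mu> a))
        \<le> ereal (cost_to_go \<gamma> b \<sigma> \<Delta> (n - k) (Var_of \<mu>) (mean_of \<mu>))"
      by (rule INF_lower2[OF opt])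
        (simp add: IH[OF opt] nk cost_to_go_Phi_eq[OF step.prems opt pos])
    show "ereal (cost_to_go \<gamma> b \<sigma> \<Delta> (n - k) (Var_of \<mu>) (mean_of \<mu>))
        \<le> (INF a\<in>lin_growth_maps. value_fun \<gamma> b \<sigma> \<Delta> n (Suc k) (Phi b \<sigma> \<Delta> \<mu> a))"
      by (rule INF_greatest) (simp add: IH nk cost_to_go_Phi_le[OF step.prems _ pos])
  qed
  finally show ?case .
qed

section \<open>Controlled states as functions of the noise\<close>

text \<open>The state is expressed as a deterministic function of a real noise sequence. This makes
  it possible to say that the state at time k reads only the first k noise values and is measurable
  in them.\<close>

primrec feedback_path ::
  "real \<Rightarrow> real \<Rightarrow> real \<Rightarrow> real \<Rightarrow> (nat \<Rightarrow> real \<Rightarrow> real) \<Rightarrow> (nat \<Rightarrow> real) \<Rightarrow> nat \<Rightarrow> real" where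
  "feedback_path b \<sigma> \<Delta> x0 a e 0 = x0"
| "feedback_path b \<sigma> \<Delta> x0 a e (Suc k) = feedback_path b \<sigma> \<Delta> x0 a e k
     + a k (feedback_path b \<sigma> \<Delta> x0 a e k) * (b * \<Delta> + \<sigma> * sqrt \<Delta> * e (Suc k))"

text \<open>A control process and its state refer to each other; under a feedback rule the recursion
  closes. The hypothesis concerns a single \<omega>, because the feedback relation is only known on
  the space of M.\<close>

lemma state_process_eq_feedback_path:
  assumes "\<And>k. k < n \<Longrightarrow> \<alpha> k \<omega> = a k (state_process b \<sigma> \<Delta> x0 \<epsilon> \<alpha> k \<omega>)" and "k \<le> n"
  shows "state_process b \<sigma> \<Delta> x0 \<epsilon> \<alpha> k \<omega> = feedback_path b \<sigma> \<Delta> x0 a (\<lambda>i. \<epsilon> i \<omega>) k"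
  using assms(2) by (induction k) (simp_all add: assms(1))

lemma feedback_path_cong:
  "(\<And>i. 1 \<le> i \<Longrightarrow> i \<le> k \<Longrightarrow> e i = e' i) \<Longrightarrow>
    feedback_path b \<sigma> \<Delta> x0 a e k = feedback_path b \<sigma> \<Delta> x0 a e' k"
  by (induction k) simp_all

lemma measurable_feedback_path:
  assumes "\<And>i. i < k \<Longrightarrow> a i \<in> borel_measurable borel" "{1..k} \<subseteq> J"
  shows "(\<lambda>e. feedback_path b \<sigma> \<Delta> x0 a e k) \<in> borel_measurable (PiM J (\<lambda>_. borel))"
  using assms
proof (induction k)
  case (Suc k)
  have [measurable]: "a k \<in> borel_measurable borel"
      "(\<lambda>e. feedback_path b \<sigma> \<Delta> x0 a e k) \<in> borel_measurable (PiM J (\<lambda>_. borel))"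
    using Suc.prems by (auto intro!: Suc.IH)
  have [measurable]: "(\<lambda>e. e (Suc k)) \<in> borel_measurable (PiM J (\<lambda>_. borel))"
    using Suc.prems(2) by (intro measurable_component_singleton) auto
  show ?case
    by simp
qed simp

section \<open>Controlled paths driven by Gaussian noise\<close>

locale gaussian_noise = prob_space M for M :: "'a measure" +
  fixes \<epsilon> :: "nat \<Rightarrow> 'a \<Rightarrow> real" and x0 b \<sigma> \<Delta> \<gamma> :: real and n :: nat
  assumes indep: "indep_vars (\<lambda>_. borel) \<epsilon> {1..}"
    and normal: "\<And>k. k \<ge> 1 \<Longrightarrow> distributed M lborel (\<epsilon> k) std_normal_density"
    and pos: "\<gamma> > 0" "\<sigma> > 0" "\<Delta> > 0"
begin

abbreviation path :: "(nat \<Rightarrow> real \<Rightarrow> real) \<Rightarrow> nat \<Rightarrow> 'a \<Rightarrow> real" where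
  "path a k \<equiv> \<lambda>\<omega>. feedback_path b \<sigma> \<Delta> x0 a (\<lambda>i. \<epsilon> i \<omega>) k"

text \<open>The state at time k is a Borel function of the noise block 1..k, which is disjoint from
  the index k + 1; disjoint blocks of an independent family are independent.\<close>

lemma indep_path_noise:
  assumes "\<And>i. i < k \<Longrightarrow> a i \<in> lin_growth_maps"
  shows "indep_var borel (path a k) borel (\<epsilon> (Suc k))"
proof -
  have "indep_var (PiM {1..k} (\<lambda>_. borel)) (\<lambda>\<omega>. restrict (\<lambda>i. \<epsilon> i \<omega>) {1..k})
      (PiM {Suc k} (\<lambda>_. borel)) (\<lambda>\<omega>. restrict (\<lambda>i. \<epsilon> i \<omega>) {Suc k})"
    by (rule indep_var_restrict[OF indep]) auto
  moreover have "(\<lambda>e. feedback_path b \<sigma> \<Delta> x0 a e k) \<in> borel_measurable (PiM {1..k} (\<lambda>_. borel))"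
    using assms by (intro measurable_feedback_path lin_growth_maps_measurable) auto
  moreover have "(\<lambda>e. e (Suc k)) \<in> borel_measurable (PiM {Suc k} (\<lambda>_. borel))"
    by (intro measurable_component_singleton) simp
  ultimately have "indep_var
      borel ((\<lambda>e. feedback_path b \<sigma> \<Delta> x0 a e k) \<circ> (\<lambda>\<omega>. restrict (\<lambda>i. \<epsilon> i \<omega>) {1..k}))
      borel ((\<lambda>e. e (Suc k)) \<circ> (\<lambda>\<omega>. restrict (\<lambda>i. \<epsilon> i \<omega>) {Suc k}))"
    by (rule indep_var_compose)
  \<comment> \<open>Restricting the noise to the indices 1..k does not change the path up to time
    k.\<close>
  moreover have "(\<lambda>e. feedback_path b \<sigma> \<Delta> x0 a e k) \<circ> (\<lambda>\<omega>. restrict (\<lambda>i. \<epsilon> i \<omega>) {1..k}) = path a k"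
    by (auto simp: fun_eq_iff intro!: feedback_path_cong)
  ultimately show ?thesis
    by (simp add: comp_def)
qed

lemma square_integrable_path:
  "(\<And>i. i < k \<Longrightarrow> a i \<in> lin_growth_maps) \<Longrightarrow> integrable M (\<lambda>\<omega>. (path a k \<omega>)\<^sup>2)"
proof (induction k)
  case (Suc k)
  have "a k \<in> lin_growth_maps" "indep_var borel (path a k) borel (\<epsilon> (Suc k))"
    using Suc.prems by (auto intro: indep_path_noise)
  from controlled_step_moments(1)[OF this normal _ pos(2,3), of b] Suc show ?case
    by simp
qed simp

lemma expectation_path_Suc:
  assumes "\<And>i. i \<le> k \<Longrightarrow> a i \<in> lin_growth_maps"
  shows "expectation (path a (Suc k)) = expectation (path a k) + b * \<Delta> * expectation (\<lambda>\<omega>. a k (path a k \<omega>))"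
  using controlled_step_moments(2)[OF _ indep_path_noise normal _ pos(2,3), of "a k" k a b]
    square_integrable_path[of k a] assms by simp

section \<open>Verification along a controlled path\<close>

lemma cost_to_go_path_Suc:
  assumes "\<And>i. i \<le> k \<Longrightarrow> a i \<in> lin_growth_maps"
  shows cost_to_go_path_Suc_le:
      "cost_to_go \<gamma> b \<sigma> \<Delta> (Suc m) (variance (path a k)) (expectation (path a k))
        \<le> cost_to_go \<gamma> b \<sigma> \<Delta> m (variance (path a (Suc k))) (expectation (path a (Suc k)))"
    and cost_to_go_path_Suc_eq: "a k = opt_feedback \<gamma> b \<sigma> \<Delta> m (expectation (path a k)) \<Longrightarrow>
      cost_to_go \<gamma> b \<sigma> \<Delta> m (variance (path a (Suc k))) (expectation (path a (Suc k)))
        = cost_to_go \<gamma> b \<sigma> \<Delta> (Suc m) (variance (path a k)) (expectation (path a k))"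
proof -
  have "a k \<in> lin_growth_maps" "indep_var borel (path a k) borel (\<epsilon> (Suc k))"
      "distributed M lborel (\<epsilon> (Suc k)) std_normal_density" "integrable M (\<lambda>\<omega>. (path a k \<omega>)\<^sup>2)"
    using assms by (auto intro: indep_path_noise normal square_integrable_path)
  note step = cost_to_go_controlled_step[OF this pos, of b m]
  show "cost_to_go \<gamma> b \<sigma> \<Delta> (Suc m) (variance (path a k)) (expectation (path a k))
      \<le> cost_to_go \<gamma> b \<sigma> \<Delta> m (variance (path a (Suc k))) (expectation (path a (Suc k)))"
    unfolding feedback_path.simps by (rule step(1))
  show "cost_to_go \<gamma> b \<sigma> \<Delta> m (variance (path a (Suc k))) (expectation (path a (Suc k)))
      = cost_to_go \<gamma> b \<sigma> \<Delta> (Suc m) (variance (path a k)) (expectation (path a k))"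
    if "a k = opt_feedback \<gamma> b \<sigma> \<Delta> m (expectation (path a k))"
    unfolding feedback_path.simps by (rule step(2)[OF that])
qed

text \<open>Along any admissible path the cost-to-go with n - k steps left is nondecreasing in k, by
  the one-step inequality. It starts at variance 0 and mean x0, and at k = n it is the cost of the
  control.\<close>

lemma cost_to_go_path_ge:
  assumes "\<And>i. i < n \<Longrightarrow> a i \<in> lin_growth_maps" and "k \<le> n"
  shows "cost_to_go \<gamma> b \<sigma> \<Delta> n 0 x0
    \<le> cost_to_go \<gamma> b \<sigma> \<Delta> (n - k) (variance (path a k)) (expectation (path a k))"
  using assms(2)
proof (induction k)
  case (Suc k)
  then have nk: "n - k = Suc (n - Suc k)"
    by simp
  have "cost_to_go \<gamma> b \<sigma> \<Delta> n 0 x0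
      \<le> cost_to_go \<gamma> b \<sigma> \<Delta> (n - k) (variance (path a k)) (expectation (path a k))"
    using Suc by simp
  also have "\<dots> \<le> cost_to_go \<gamma> b \<sigma> \<Delta> (n - Suc k)
      (variance (path a (Suc k))) (expectation (path a (Suc k)))"
    unfolding nk using assms(1) Suc.prems by (intro cost_to_go_path_Suc_le) simp
  finally show ?case .
qed (simp add: prob_space)

text \<open>Under the optimal feedback each one-step inequality is an equality, so the cost-to-go
  stays constant along the path.\<close>

lemma cost_to_go_path_eq:
  assumes "\<And>i. i < n \<Longrightarrow> a i = opt_feedback \<gamma> b \<sigma> \<Delta> (n - Suc i) (expectation (path a i))" and "k \<le> n"
  shows "cost_to_go \<gamma> b \<sigma> \<Delta> (n - k) (variance (path a k)) (expectation (path a k))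
    = cost_to_go \<gamma> b \<sigma> \<Delta> n 0 x0"
  using assms(2)
proof (induction k)
  case (Suc k)
  then have nk: "n - k = Suc (n - Suc k)"
    by simp
  \<comment> \<open>Linear growth comes from the affine form of the optimal feedback.\<close>
  have "a i \<in> lin_growth_maps" if "i \<le> k" for i
    using assms(1)[of i] that Suc.prems opt_feedback_lin_growth by simp
  then have "cost_to_go \<gamma> b \<sigma> \<Delta> (n - Suc k) (variance (path a (Suc k))) (expectation (path a (Suc k)))
      = cost_to_go \<gamma> b \<sigma> \<Delta> (n - k) (variance (path a k)) (expectation (path a k))"
    unfolding nk using assms(1) Suc.prems by (intro cost_to_go_path_Suc_eq) auto
  also have "\<dots> = cost_to_go \<gamma> b \<sigma> \<Delta> n 0 x0"
    using Suc by simp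
  finally show ?case .
qed (simp add: prob_space)

section \<open>The cost of a feedback control and the explicit optimal control\<close>

text \<open>The controlled state agrees with the path on the space of M, hence has the same mean and
  variance, and \<open>cost_to_go\<close> with no steps left is the terminal cost.\<close>

lemma mv_cost_feedback:
  assumes "\<And>k \<omega>. k < n \<Longrightarrow> \<omega> \<in> space M \<Longrightarrow> \<alpha> k \<omega> = a k (state_process b \<sigma> \<Delta> x0 \<epsilon> \<alpha> k \<omega>)"
  shows "mv_cost \<gamma> b \<sigma> \<Delta> x0 \<epsilon> n M \<alpha> = cost_to_go \<gamma> b \<sigma> \<Delta> 0 (variance (path a n)) (expectation (path a n))"
proof -
  have eq: "state_process b \<sigma> \<Delta> x0 \<epsilon> \<alpha> n \<omega> = path a n \<omega>" if "\<omega> \<in> space M" for \<omega>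
    using assms that by (intro state_process_eq_feedback_path[of n]) auto
  then have E: "expectation (state_process b \<sigma> \<Delta> x0 \<epsilon> \<alpha> n) = expectation (path a n)"
    by (intro Bochner_Integration.integral_cong) simp_all
  have "variance (state_process b \<sigma> \<Delta> x0 \<epsilon> \<alpha> n) = variance (path a n)"
    unfolding E using eq by (intro Bochner_Integration.integral_cong) simp_all
  with E show ?thesis
    by (simp add: mv_cost_def cost_to_go_def)
qed

text \<open>The explicit control depends on the state only; the mean along its path telescopes, which
  turns it into the optimal feedback centred at the mean.\<close>

lemma explicit_feedback_optimal:
  defines "a \<equiv> \<lambda>_ y. - (b / (\<sigma>\<^sup>2 + b\<^sup>2 * \<Delta>)) * (y - x0 - 1 / \<gamma> * (1 + b\<^sup>2 / \<sigma>\<^sup>2 * \<Delta>) ^ n)"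
  assumes "k < n"
  shows "a k = opt_feedback \<gamma> b \<sigma> \<Delta> (n - Suc k) (expectation (path a k))"
proof -
  define S where "S = \<sigma>\<^sup>2 + b\<^sup>2 * \<Delta>"
  define p where "p = S / \<sigma>\<^sup>2"
  have S: "S > 0" and p: "p > 0"
    using pos by (simp_all add: S_def p_def add_pos_nonneg)
  have p1: "1 + b\<^sup>2 / \<sigma>\<^sup>2 * \<Delta> = p"
    using pos by (simp add: p_def S_def field_simps)
  \<comment> \<open>The explicit control steers towards the fixed level x0 + p^n / \<gamma>; the
    summand 0 brings it to the form of \<open>affine_lin_growth\<close>.\<close>
  have a_eq: "a = (\<lambda>_ y. - (b / S) * (y - (x0 + p ^ n / \<gamma>)) + 0)"
    unfolding a_def p1 S_def by (simp add: diff_diff_eq)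
  have lin: "a i \<in> lin_growth_maps" for i
    unfolding a_eq by (rule affine_lin_growth)
  \<comment> \<open>Each step multiplies the distance of the mean from this level by 1 - b^2 Delta /
    S = 1/p. It starts at p^n / \<gamma>, so it is p^(n-k) / \<gamma> at time k.\<close>
  have mean: "expectation (path a k) = x0 + (p ^ n - p ^ (n - k)) / \<gamma>" if "k \<le> n" for k
    using that
  proof (induction k)
    case (Suc k)
    have nk: "p ^ (n - k) = p * p ^ (n - Suc k)"
      using Suc.prems by (simp flip: power_Suc add: Suc_diff_Suc)
    have "path a k \<in> borel_measurable M"
      using indep_var_rv1[OF indep_path_noise[of k a]] lin by simp
    then have "integrable M (path a k)"
      using square_integrable_imp_integrable square_integrable_path[of k a] lin by blast
    then have "expectation (\<lambda>\<omega>. a k (path a k \<omega>)) = - (b / S) * (expectation (path a k) - (x0 + p ^ n / \<gamma>))"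
      unfolding a_eq by (simp add: prob_space)
    also have "expectation (path a k) = x0 + (p ^ n - p * p ^ (n - Suc k)) / \<gamma>"
      using Suc nk by simp
    also have "- (b / S) * (x0 + (p ^ n - p * p ^ (n - Suc k)) / \<gamma> - (x0 + p ^ n / \<gamma>)) =
        b / S * (p * p ^ (n - Suc k)) / \<gamma>"
      by (simp add: diff_divide_distrib)
    \<comment> \<open>The increment of the mean is the difference of p^(n-k) and p^(n-k-1), divided
      by \<gamma>.\<close>
    also have "b * \<Delta> * \<dots> = (p - 1) * p ^ (n - Suc k) / \<gamma>"
    proof -
      have "b * \<Delta> * (b / S) * p = b\<^sup>2 / \<sigma>\<^sup>2 * \<Delta>"
        using S unfolding p_def by (simp add: power2_eq_square)
      also have "\<dots> = p - 1"
        using p1 by simp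
      finally have "b * \<Delta> * (b / S) * p = p - 1" .
      moreover have "b * \<Delta> * (b / S * (p * p ^ (n - Suc k)) / \<gamma>) =
          b * \<Delta> * (b / S) * p * p ^ (n - Suc k) / \<gamma>"
        by simp
      ultimately show ?thesis
        by (simp only:)
    qed
    finally show ?case
      using expectation_path_Suc[of k a] lin Suc nk
      by (simp add: diff_divide_distrib algebra_simps)
  qed (simp add: prob_space)
  \<comment> \<open>Both controls have slope -b/S. Centred at the mean, the explicit one has the
    constant term on the left, by \<open>mean\<close>, and the optimal feedback the one on the
    right; they agree because (b/S) p = b/sigma^2.\<close>
  have "b / S * p ^ (n - k) / \<gamma> = b / (\<sigma>\<^sup>2 * \<gamma>) * p ^ (n - Suc k)"
  proof -
    have "p ^ (n - k) = S / \<sigma>\<^sup>2 * p ^ (n - Suc k)"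
      using assms by (simp flip: power_Suc p_def add: Suc_diff_Suc)
    then show ?thesis
      using S by simp
  qed
  then show ?thesis
    unfolding opt_feedback_def S_def[symmetric] p_def[symmetric] mean[OF less_imp_le[OF assms(2)]]
    unfolding a_eq by (simp add: fun_eq_iff diff_divide_distrib algebra_simps)
qed

end

theorem mainTheorem4:
  fixes M :: "'a measure" and \<epsilon> :: "nat \<Rightarrow> 'a \<Rightarrow> real"
    and n :: nat and \<gamma> x0 b \<sigma> \<Delta> :: real
  assumes "prob_space M"
    and "prob_space.indep_vars M (\<lambda>_. borel) \<epsilon> {1..}"
    and "\<And>k. k \<ge> 1 \<Longrightarrow> distributed M lborel (\<epsilon> k) std_normal_density"
    and "n \<ge> 1" and "\<gamma> > 0" and "b > 0" and "\<sigma> > 0" and "\<Delta> > 0"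
  shows "(\<forall>k\<le>n. \<forall>\<mu>\<in>P2. value_fun \<gamma> b \<sigma> \<Delta> n k \<mu> =
            ereal (\<gamma> / 2 * (\<sigma>\<^sup>2 / (\<sigma>\<^sup>2 + b\<^sup>2 * \<Delta>)) ^ (n - k) * Var_of \<mu> - mean_of \<mu>
                   - 1 / (2 * \<gamma>) * (((\<sigma>\<^sup>2 + b\<^sup>2 * \<Delta>) / \<sigma>\<^sup>2) ^ (n - k) - 1)))
       \<and> (\<exists>\<alpha> \<in> feedback_controls b \<sigma> \<Delta> x0 \<epsilon> n M.
            ereal (mv_cost \<gamma> b \<sigma> \<Delta> x0 \<epsilon> n M \<alpha>) =
              (INF \<beta> \<in> feedback_controls b \<sigma> \<Delta> x0 \<epsilon> n M. ereal (mv_cost \<gamma> b \<sigma> \<Delta> x0 \<epsilon> n M \<beta>))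
          \<and> (\<forall>k<n. \<forall>\<omega>\<in>space M.
               \<alpha> k \<omega> = - (b / (\<sigma>\<^sup>2 + b\<^sup>2 * \<Delta>)) *
                          (state_process b \<sigma> \<Delta> x0 \<epsilon> \<alpha> k \<omega>
                           - prob_space.expectation M (state_process b \<sigma> \<Delta> x0 \<epsilon> \<alpha> k))
                        + b / (\<sigma>\<^sup>2 * \<gamma>) * ((\<sigma>\<^sup>2 + b\<^sup>2 * \<Delta>) / \<sigma>\<^sup>2) ^ (n - k - 1))
          \<and> (\<forall>k<n. \<forall>\<omega>\<in>space M.
               \<alpha> k \<omega> = - (b / (\<sigma>\<^sup>2 + b\<^sup>2 * \<Delta>)) *
                          (state_process b \<sigma> \<Delta> x0 \<epsilon> \<alpha> k \<omega> - x0
                           - 1 / \<gamma> * (1 + b\<^sup>2 / \<sigma>\<^sup>2 * \<Delta>) ^ n)))"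
proof (intro conjI allI ballI impI)
  interpret gaussian_noise M \<epsilon> x0 b \<sigma> \<Delta> \<gamma> n
    using assms by (intro gaussian_noise.intro gaussian_noise_axioms.intro)
  fix k \<mu> assume "k \<le> n" "\<mu> \<in> P2"
  then show "value_fun \<gamma> b \<sigma> \<Delta> n k \<mu> =
      ereal (\<gamma> / 2 * (\<sigma>\<^sup>2 / (\<sigma>\<^sup>2 + b\<^sup>2 * \<Delta>)) ^ (n - k) * Var_of \<mu> - mean_of \<mu>
        - 1 / (2 * \<gamma>) * (((\<sigma>\<^sup>2 + b\<^sup>2 * \<Delta>) / \<sigma>\<^sup>2) ^ (n - k) - 1))"
    using value_fun_eq_cost_to_go[OF pos] by (simp add: cost_to_go_def)
next
  interpret gaussian_noise M \<epsilon> x0 b \<sigma> \<Delta> \<gamma> n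
    using assms by (intro gaussian_noise.intro gaussian_noise_axioms.intro)
  define a where "a = (\<lambda>(_::nat) y. - (b / (\<sigma>\<^sup>2 + b\<^sup>2 * \<Delta>)) * (y - x0 - 1 / \<gamma> * (1 + b\<^sup>2 / \<sigma>\<^sup>2 * \<Delta>) ^ n))"
  \<comment> \<open>The control is defined through \<open>path\<close>, which does not refer to
    \<alpha>; \<open>state\<close> then shows that this path is the state controlled by \<alpha>, so
    the circular feedback relation holds.\<close>
  define \<alpha> where "\<alpha> = (\<lambda>k \<omega>. a k (path a k \<omega>))"
  have state: "state_process b \<sigma> \<Delta> x0 \<epsilon> \<alpha> k = path a k" for k
    by (induction k) (simp_all add: \<alpha>_def)
  have \<alpha>_app: "\<alpha> k \<omega> = a k (path a k \<omega>)" for k \<omega>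
    by (simp add: \<alpha>_def)
  have opt: "a k = opt_feedback \<gamma> b \<sigma> \<Delta> (n - Suc k) (expectation (path a k))" if "k < n" for k
    unfolding a_def using explicit_feedback_optimal[OF that] .
  have lin: "a k \<in> lin_growth_maps" if "k < n" for k
    unfolding opt[OF that] by (rule opt_feedback_lin_growth)
  let ?C = "feedback_controls b \<sigma> \<Delta> x0 \<epsilon> n M"
  have mem: "\<alpha> \<in> ?C"
    unfolding feedback_controls_def using lin by (auto simp: state \<alpha>_app intro!: exI[of _ a])
  have cost: "mv_cost \<gamma> b \<sigma> \<Delta> x0 \<epsilon> n M \<alpha> = cost_to_go \<gamma> b \<sigma> \<Delta> n 0 x0"
    using mv_cost_feedback[of \<alpha> a] cost_to_go_path_eq[of a n] opt by (simp add: state \<alpha>_app)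
  \<comment> \<open>The bound is common to all competitors and equals the cost of \<alpha>, so
    \<alpha> attains the infimum.\<close>
  have low: "cost_to_go \<gamma> b \<sigma> \<Delta> n 0 x0 \<le> mv_cost \<gamma> b \<sigma> \<Delta> x0 \<epsilon> n M \<beta>" if \<beta>: "\<beta> \<in> ?C" for \<beta>
  proof -
    obtain c where "\<And>k. k < n \<Longrightarrow> c k \<in> lin_growth_maps"
      and "\<And>k \<omega>. k < n \<Longrightarrow> \<omega> \<in> space M \<Longrightarrow> \<beta> k \<omega> = c k (state_process b \<sigma> \<Delta> x0 \<epsilon> \<beta> k \<omega>)"
      using \<beta> unfolding feedback_controls_def by blast
    then show ?thesis
      using cost_to_go_path_ge[of c n] mv_cost_feedback[of \<beta> c] by simp
  qed
  have inf: "ereal (mv_cost \<gamma> b \<sigma> \<Delta> x0 \<epsilon> n M \<alpha>) = (INF \<beta>\<in>?C. ereal (mv_cost \<gamma> b \<sigma> \<Delta> x0 \<epsilon> n M \<beta>))"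
    by (rule antisym[OF INF_greatest INF_lower[OF mem]]) (simp add: cost low)
  show "\<exists>\<alpha>\<in>?C.
      ereal (mv_cost \<gamma> b \<sigma> \<Delta> x0 \<epsilon> n M \<alpha>) = (INF \<beta>\<in>?C. ereal (mv_cost \<gamma> b \<sigma> \<Delta> x0 \<epsilon> n M \<beta>))
    \<and> (\<forall>k<n. \<forall>\<omega>\<in>space M. \<alpha> k \<omega> = - (b / (\<sigma>\<^sup>2 + b\<^sup>2 * \<Delta>)) *
          (state_process b \<sigma> \<Delta> x0 \<epsilon> \<alpha> k \<omega> - expectation (state_process b \<sigma> \<Delta> x0 \<epsilon> \<alpha> k))
          + b / (\<sigma>\<^sup>2 * \<gamma>) * ((\<sigma>\<^sup>2 + b\<^sup>2 * \<Delta>) / \<sigma>\<^sup>2) ^ (n - k - 1))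
    \<and> (\<forall>k<n. \<forall>\<omega>\<in>space M. \<alpha> k \<omega> = - (b / (\<sigma>\<^sup>2 + b\<^sup>2 * \<Delta>)) *
          (state_process b \<sigma> \<Delta> x0 \<epsilon> \<alpha> k \<omega> - x0 - 1 / \<gamma> * (1 + b\<^sup>2 / \<sigma>\<^sup>2 * \<Delta>) ^ n))"
  proof (intro bexI[OF _ mem] conjI inf allI impI ballI)
    fix k \<omega> assume "k < n"
    have "\<alpha> k \<omega> = a k (path a k \<omega>)"
      by (rule \<alpha>_app)
    also have "\<dots> = opt_feedback \<gamma> b \<sigma> \<Delta> (n - Suc k) (expectation (path a k)) (path a k \<omega>)"
      using opt[OF \<open>k < n\<close>] by (rule fun_cong)
    finally show "\<alpha> k \<omega> = - (b / (\<sigma>\<^sup>2 + b\<^sup>2 * \<Delta>)) *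
        (state_process b \<sigma> \<Delta> x0 \<epsilon> \<alpha> k \<omega> - expectation (state_process b \<sigma> \<Delta> x0 \<epsilon> \<alpha> k))
        + b / (\<sigma>\<^sup>2 * \<gamma>) * ((\<sigma>\<^sup>2 + b\<^sup>2 * \<Delta>) / \<sigma>\<^sup>2) ^ (n - k - 1)"
      unfolding opt_feedback_def state by simp
    show "\<alpha> k \<omega> = - (b / (\<sigma>\<^sup>2 + b\<^sup>2 * \<Delta>)) *
        (state_process b \<sigma> \<Delta> x0 \<epsilon> \<alpha> k \<omega> - x0 - 1 / \<gamma> * (1 + b\<^sup>2 / \<sigma>\<^sup>2 * \<Delta>) ^ n)"
      unfolding state \<alpha>_app by (simp add: a_def)
  qed
qed

end
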